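(* Let $H=\operatorname{diag}(0,1,1,3)$ in the ordered basis $(|0\rangle,|1a\rangle,|1b\rangle,|3\rangle)$ of $\mathbb C^4$, let $\beta=1$, let $$\rho=\begin{pmatrix}0.35&0.05&0&0.04\\0.05&0.25&0&0\\0&0&0.20&0.05\\0.04&0&0.05&0.20\end{pmatrix},$$ and $p^f=(0.50,0.35,0.15)$. With $\Gamma_{\mathrm{CGP}}(\rho,p^f)$ and $L_{01a},L_{1b3},L_{03}$ as defined in the context, put $L_k^{\star,\mathrm{CGP}}:=\sup_{\Phi\in\Gamma_{\mathrm{CGP}}(\rho,p^f)}L_k(\Phi)$ for $k\in\{01a,1b3,03\}$ and $S_{\rm sum}^{\star,\mathrm{CGP}}:=\sup_{\Phi\in\Gamma_{\mathrm{CGP}}(\rho,p^f)}[L_{01a}(\Phi)+L_{1b3}(\Phi)+L_{03}(\Phi)]$. Then $$L_{01a}^{\star,\mathrm{CGP}}+L_{1b3}^{\star,\mathrm{CGP}}+L_{03}^{\star,\mathrm{CGP}}\ \ge\ 0.1030097\ >\ 0.1030090$$ and $$S_{\rm sum}^{\star,\mathrm{CGP}}\ \le\ 0.0881264\ <\ 0.0881270 .$$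
   Context: Let $\gamma=\frac1Z\operatorname{diag}(1,e^{-1},e^{-1},e^{-3})$, $Z=1+2e^{-1}+e^{-3}$, and let $\Pi_0=|0\rangle\langle0|$, $\Pi_1=|1a\rangle\langle1a|+|1b\rangle\langle1b|$, $\Pi_3=|3\rangle\langle3|$. $\Gamma_{\mathrm{CGP}}(\rho,p^f)$ is the set of completely positive trace-preserving maps $\Phi:M_4(\mathbb C)\to M_4(\mathbb C)$ such that $\Phi(\gamma)=\gamma$; $\Phi(e^{-itH}Xe^{itH})=e^{-itH}\Phi(X)e^{itH}$ for all $X$ and all $t\in\mathbb R$; and $\mathrm{Tr}(\Pi_0\Phi(\rho))=0.50$, $\mathrm{Tr}(\Pi_1\Phi(\rho))=0.35$, $\mathrm{Tr}(\Pi_3\Phi(\rho))=0.15$. The functionals are $L_{01a}(\Phi)=\operatorname{Re}\langle0|\Phi(\rho)|1a\rangle$, $L_{1b3}(\Phi)=\operatorname{Re}\langle1b|\Phi(\rho)|3\rangle$, $L_{03}(\Phi)=\operatorname{Re}\langle0|\Phi(\rho)|3\rangle$. All decimals are exact rational numbers. *)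

theory Defs
  imports "HOL-Analysis.Analysis"
begin

definition cscale :: "complex \<Rightarrow> complex^'n^'m \<Rightarrow> complex^'n^'m" where
  "cscale c A = (\<chi> i j. c * A $ i $ j)"

definition diag_mat :: "complex^'n \<Rightarrow> complex^'n^'n" where
  "diag_mat d = (\<chi> i j. if i = j then d $ i else 0)"

text \<open>Library multiplication and powers on \<open>complex^'n^'n\<close> are entrywise, so the power series is
  written with iterated \<open>(**)\<close>.\<close>

definition mat_exp :: "complex^'n^'n \<Rightarrow> complex^'n^'n" where
  "mat_exp A = (\<Sum>k. (1 / fact k) *\<^sub>R (((**) A ^^ k) (mat 1)))"

definition braket :: "complex^'n \<Rightarrow> complex^'n \<Rightarrow> complex" where
  "braket v w = (\<Sum>i\<in>UNIV. cnj (v $ i) * w $ i)"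

definition ketbra :: "complex^'n \<Rightarrow> complex^'n \<Rightarrow> complex^'n^'n" where
  "ketbra v w = (\<chi> i j. v $ i * cnj (w $ j))"

text \<open>\<open>X\<close> stands for the \<open>n \<times> n\<close> block matrix \<open>\<Sum>i,j<n. E\<^sub>i\<^sub>j \<otimes> X i j\<close>, and \<open>v\<close> for the block vector
  with components \<open>v i\<close>. Over the complex numbers, a nonnegative real quadratic form already
  implies that the block matrix is Hermitian.\<close>

definition block_psd :: "nat \<Rightarrow> (nat \<Rightarrow> nat \<Rightarrow> complex^'n^'n) \<Rightarrow> bool" where
  "block_psd n X \<longleftrightarrow>
     (\<forall>v. (\<Sum>i<n. \<Sum>j<n. braket (v i) (X i j *v v j)) \<in> \<real>\<^sub>\<ge>\<^sub>0)"

text \<open>Positivity of \<open>id\<^sub>n \<otimes> \<Phi>\<close> for every \<open>n\<close>.\<close>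

definition completely_positive :: "(complex^'n^'n \<Rightarrow> complex^'m^'m) \<Rightarrow> bool" where
  "completely_positive \<Phi> \<longleftrightarrow>
     (\<forall>n X. block_psd n X \<longrightarrow> block_psd n (\<lambda>i j. \<Phi> (X i j)))"

definition cptp :: "(complex^'n^'n \<Rightarrow> complex^'m^'m) \<Rightarrow> bool" where
  "cptp \<Phi> \<longleftrightarrow>
     Vector_Spaces.linear cscale cscale \<Phi> \<and>
     completely_positive \<Phi> \<and>
     (\<forall>X. trace (\<Phi> X) = trace X)"

text \<open>The indices \<open>1, 2, 3, 4\<close> of type \<open>4\<close> are the ordered basis \<open>|0\<rangle>, |1a\<rangle>, |1b\<rangle>, |3\<rangle>\<close>.\<close>

definition ket0 :: "complex^4" where "ket0 = axis 1 1"
definition ket1a :: "complex^4" where "ket1a = axis 2 1"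
definition ket1b :: "complex^4" where "ket1b = axis 3 1"
definition ket3 :: "complex^4" where "ket3 = axis 4 1"

definition ham :: "complex^4^4" where
  "ham = diag_mat (vector [0, 1, 1, 3])"

definition gibbs :: "complex^4^4" where
  "gibbs = (let Z = 1 + 2 * exp (- 1) + exp (- 3)
            in cscale (1 / Z) (diag_mat (vector [1, exp (- 1), exp (- 1), exp (- 3)])))"

definition Proj0 :: "complex^4^4" where "Proj0 = ketbra ket0 ket0"
definition Proj1 :: "complex^4^4" where "Proj1 = ketbra ket1a ket1a + ketbra ket1b ket1b"
definition Proj3 :: "complex^4^4" where "Proj3 = ketbra ket3 ket3"

definition covariant :: "(complex^4^4 \<Rightarrow> complex^4^4) \<Rightarrow> bool" where
  "covariant \<Phi> \<longleftrightarrow>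
     (\<forall>X. \<forall>t::real.
        \<Phi> (mat_exp (cscale (- \<i> * of_real t) ham) ** X ** mat_exp (cscale (\<i> * of_real t) ham)) =
        mat_exp (cscale (- \<i> * of_real t) ham) ** \<Phi> X ** mat_exp (cscale (\<i> * of_real t) ham))"

text \<open>\<open>p $ 1\<close>, \<open>p $ 2\<close>, \<open>p $ 3\<close> are the final populations of the energies \<open>0\<close>, \<open>1\<close>, \<open>3\<close>.\<close>

definition Gamma_CGP :: "complex^4^4 \<Rightarrow> real^3 \<Rightarrow> (complex^4^4 \<Rightarrow> complex^4^4) set" where
  "Gamma_CGP \<rho> p =
     {\<Phi>. cptp \<Phi> \<and> \<Phi> gibbs = gibbs \<and> covariant \<Phi> \<and>
         trace (Proj0 ** \<Phi> \<rho>) = of_real (p $ 1) \<and>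
         trace (Proj1 ** \<Phi> \<rho>) = of_real (p $ 2) \<and>
         trace (Proj3 ** \<Phi> \<rho>) = of_real (p $ 3)}"

definition L01a :: "complex^4^4 \<Rightarrow> (complex^4^4 \<Rightarrow> complex^4^4) \<Rightarrow> real" where
  "L01a \<rho> \<Phi> = Re (braket ket0 (\<Phi> \<rho> *v ket1a))"

definition L1b3 :: "complex^4^4 \<Rightarrow> (complex^4^4 \<Rightarrow> complex^4^4) \<Rightarrow> real" where
  "L1b3 \<rho> \<Phi> = Re (braket ket1b (\<Phi> \<rho> *v ket3))"

definition L03 :: "complex^4^4 \<Rightarrow> (complex^4^4 \<Rightarrow> complex^4^4) \<Rightarrow> real" where
  "L03 \<rho> \<Phi> = Re (braket ket0 (\<Phi> \<rho> *v ket3))"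

lemma vector_4 [simp]:
  "(vector [a, b, c, d] :: 'a::zero^4) $ 1 = a"
  "(vector [a, b, c, d] :: 'a::zero^4) $ 2 = b"
  "(vector [a, b, c, d] :: 'a::zero^4) $ 3 = c"
  "(vector [a, b, c, d] :: 'a::zero^4) $ 4 = d"
  unfolding vector_def by simp_all

lemma vector_space_cscale: "vector_space (cscale :: complex \<Rightarrow> complex^'n^'m \<Rightarrow> _)"
  by unfold_locales (simp_all add: cscale_def vec_eq_iff algebra_simps)

lemma linear_cscale_iff:
  "Vector_Spaces.linear cscale cscale \<Phi> \<longleftrightarrow>
     (\<forall>X Y. \<Phi> (X + Y) = \<Phi> X + \<Phi> Y) \<and> (\<forall>c X. \<Phi> (cscale c X) = cscale c (\<Phi> X))"
  by (auto simp: Vector_Spaces.linear_iff vector_space_cscale)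

lemma braket_axis: "braket (axis i 1) (A *v axis j 1) = A $ i $ j"
proof -
  have "braket (axis i 1) (A *v axis j 1) = (\<Sum>k\<in>UNIV. if k = i then A $ k $ j else 0)"
    unfolding braket_def
    by (intro sum.cong refl) (auto simp: axis_def matrix_vector_mult_def if_distrib cong: if_cong)
  then show ?thesis by simp
qed

lemma cscale_diag_mat: "cscale c (diag_mat d) = diag_mat (\<chi> i. c * d $ i)"
  by (simp add: cscale_def diag_mat_def vec_eq_iff)

lemma diag_mat_mult: "diag_mat d ** diag_mat e = diag_mat (\<chi> i. d $ i * e $ i)"
proof -
  have "(\<Sum>k\<in>UNIV. (if i = k then d $ i else 0) * (if k = j then e $ k else 0)) =
        (\<Sum>k\<in>UNIV. if k = i then (if i = j then d $ i * e $ i else 0) else 0)" for i j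
    by (intro sum.cong) auto
  then show ?thesis
    by (simp add: diag_mat_def matrix_matrix_mult_def vec_eq_iff)
qed

lemma diag_mat_funpow: "((**) (diag_mat d) ^^ k) (mat 1) = diag_mat (\<chi> i. d $ i ^ k)"
proof (induction k)
  case 0
  show ?case by (simp add: diag_mat_def mat_def vec_eq_iff)
next
  case (Suc k)
  then show ?case by (simp add: diag_mat_mult)
qed

lemma mat_exp_diag_mat: "mat_exp (diag_mat d) = diag_mat (\<chi> i. exp (d $ i))"
proof -
  have "(\<lambda>k. (1 / fact k) *\<^sub>R (((**) (diag_mat d) ^^ k) (mat 1))) sums diag_mat (\<chi> i. exp (d $ i))"
    unfolding sums_def diag_mat_funpow
  proof (intro vec_tendstoI)
    fix i j
    have "(\<lambda>n. \<Sum>k<n. d $ i ^ k /\<^sub>R fact k) \<longlonglongrightarrow> exp (d $ i)"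
      using exp_converges[of "d $ i"] by (simp add: sums_def)
    then show "(\<lambda>n. (\<Sum>k<n. (1 / fact k) *\<^sub>R diag_mat (\<chi> i. d $ i ^ k)) $ i $ j)
          \<longlonglongrightarrow> diag_mat (\<chi> i. exp (d $ i)) $ i $ j"
      by (cases "i = j") (simp_all add: diag_mat_def divide_inverse)
  qed
  then show ?thesis
    unfolding mat_exp_def by (rule sums_unique[symmetric])
qed

lemma mat_exp_ham:
  "mat_exp (cscale c ham) = diag_mat (vector [1, exp c, exp c, exp (3 * c)])"
  by (simp add: ham_def cscale_diag_mat mat_exp_diag_mat)
     (simp add: diag_mat_def vec_eq_iff forall_4 mult.commute)

text \<open>\<open>gibbs\<close> is the thermal state of \<open>ham\<close> at inverse temperature \<open>\<beta> = 1\<close>.\<close>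

lemma gibbs_thermal:
  assumes "\<beta> = (1::real)"
  shows "gibbs = cscale (1 / trace (mat_exp (cscale (- of_real \<beta>) ham)))
                   (mat_exp (cscale (- of_real \<beta>) ham))"
  using assms
  by (simp add: mat_exp_ham gibbs_def Let_def)
     (simp add: trace_def diag_mat_def sum_4 add.assoc)

end

(* The gaps 1, 2, 3 between the energies are distinct, so for a covariant channel each of the three
   output coherences is the same entry of rho times an entry of the Choi matrix, and the populations
   evolve by a Gibbs-preserving stochastic matrix P. Positivity bounds the coherence factors by
   sqrt (P i i * P j j), and a channel built from P attains all these bounds at once. The suprema are
   thus concave programs over P: three explicit matrices bound the individual ones from below; for the
   sum, AM-GM with fixed weights replaces each square root by a linear function, and an explicit dual
   solution of the resulting linear program bounds it from above. *)

theory Submission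
  imports Defs
begin

section \<open>Matrix units and the Choi matrix of a completely positive map\<close>

definition munit :: "'m \<Rightarrow> 'n \<Rightarrow> complex^'n^'m" where
  "munit i j = (\<chi> k l. if k = i \<and> l = j then 1 else 0)"

lemma braket_axis_axis: "braket (axis i x) (A *v axis j y) = cnj x * A $ i $ j * y"
proof -
  have "braket (axis i x) (A *v axis j y) = (\<Sum>k\<in>UNIV. if k = i then cnj x * A $ k $ j * y else 0)"
    unfolding braket_def
    by (intro sum.cong refl) (auto simp: axis_def matrix_vector_mult_def if_distrib cong: if_cong)
  then show ?thesis by simp
qed

lemma braket_munit: "braket v (munit i j *v w) = cnj (v $ i) * w $ j"
proof -
  have "(munit i j *v w) $ k = (if k = i then w $ j else 0)" for k
  proof -
    have "(munit i j *v w) $ k = (\<Sum>l\<in>UNIV. if l = j then (if k = i then w $ l else 0) else 0)"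
      unfolding matrix_vector_mult_def munit_def vec_lambda_beta by (intro sum.cong) auto
    then show ?thesis by simp
  qed
  then show ?thesis by (simp add: braket_def if_distrib[of "\<lambda>x. _ * x"] cong: if_cong)
qed

text \<open>The block form is the squared modulus of the sum of the entries
  \<open>v a $ f a\<close>. Mapping these blocks by \<Phi> produces compressions of its Choi matrix,
  which is how complete positivity is exploited below.\<close>

lemma block_psd_munit: "block_psd n (\<lambda>a b. munit (f a) (f b))"
  unfolding block_psd_def
proof
  fix v :: "nat \<Rightarrow> complex^'a"
  define s where "s = (\<Sum>a<n. v a $ f a)"
  have "(\<Sum>a<n. \<Sum>b<n. braket (v a) (munit (f a) (f b) *v v b)) = cnj s * s"
    by (simp add: s_def braket_munit sum_product)
  also have "\<dots> = of_real ((cmod s)\<^sup>2)"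
    by (metis complex_norm_square mult.commute)
  also have "\<dots> \<in> \<real>\<^sub>\<ge>\<^sub>0"
    by (simp add: complex_nonneg_Reals_iff)
  finally show "(\<Sum>a<n. \<Sum>b<n. braket (v a) (munit (f a) (f b) *v v b)) \<in> \<real>\<^sub>\<ge>\<^sub>0" .
qed

lemma completely_positive_munit_diag:
  assumes "completely_positive \<Phi>"
  shows "\<Phi> (munit i i) $ k $ k \<in> \<real>\<^sub>\<ge>\<^sub>0"
proof -
  have "block_psd 1 (\<lambda>a b. \<Phi> (munit i i))"
    using assms block_psd_munit[of 1 "\<lambda>_. i"] unfolding completely_positive_def by auto
  then have "(\<Sum>a<1::nat. \<Sum>b<1::nat. braket (axis k 1) (\<Phi> (munit i i) *v axis k 1)) \<in> \<real>\<^sub>\<ge>\<^sub>0"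
    unfolding block_psd_def by (elim allE[of _ "\<lambda>_::nat. axis k 1"])
  then show ?thesis by (simp add: braket_axis_axis)
qed

text \<open>The principal 2x2 block of the Choi matrix at the positions \<open>(i, k)\<close> and
  \<open>(j, l)\<close> is positive semidefinite. Stating this with free weights instead of a square
  root of a product keeps the bound linear in the diagonal entries, as the linear program
  requires.\<close>

lemma completely_positive_gram:
  fixes \<alpha> \<beta> :: real
  assumes "completely_positive \<Phi>"
  shows "2 * \<alpha> * \<beta> * Re (\<Phi> (munit i j) $ k $ l) \<le>
    \<alpha>\<^sup>2 * Re (\<Phi> (munit i i) $ k $ k) + \<beta>\<^sup>2 * Re (\<Phi> (munit j j) $ l $ l)"
proof -
  define f where "f a = (if a = (0::nat) then i else j)" for a
  have "block_psd 2 (\<lambda>a b. \<Phi> (munit (f a) (f b)))"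
    using assms block_psd_munit unfolding completely_positive_def by blast
  note psd = this[unfolded block_psd_def, rule_format]
  have Q: "cnj x * \<Phi> (munit i i) $ k $ k * x + cnj x * \<Phi> (munit i j) $ k $ l * y
      + (cnj y * \<Phi> (munit j i) $ l $ k * x + cnj y * \<Phi> (munit j j) $ l $ l * y) \<in> \<real>\<^sub>\<ge>\<^sub>0" for x y
    using psd[of "\<lambda>a. if a = 0 then axis k x else axis l y"]
    by (simp add: numeral_2_eq_2 f_def braket_axis_axis)
  have D: "Im (\<Phi> (munit i i) $ k $ k) = 0" "Im (\<Phi> (munit j j) $ l $ l) = 0"
    using completely_positive_munit_diag[OF assms] by (simp_all add: complex_nonneg_Reals_iff)
  \<comment> \<open>an imaginary relative phase yields the Hermiticity of the Choi matrix\<close>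
  have "Re (\<Phi> (munit j i) $ l $ k) = Re (\<Phi> (munit i j) $ k $ l)"
    using Q[of 1 \<i>] D by (simp add: complex_nonneg_Reals_iff)
  \<comment> \<open>With real weights of opposite sign the two cross terms coincide and give the
    factor 2.\<close>
  then show ?thesis
    using Q[of "of_real \<alpha>" "- of_real \<beta>"]
    by (simp add: complex_nonneg_Reals_iff power2_eq_square algebra_simps)
qed

text \<open>Expansion of \<open>X\<close> in matrix units. For a covariant map most coefficients in
  this double sum vanish.\<close>

lemma linear_munit_expand:
  assumes "Vector_Spaces.linear cscale cscale \<Phi>"
  shows "\<Phi> X $ k $ l = (\<Sum>i\<in>UNIV. \<Sum>j\<in>UNIV. X $ i $ j * \<Phi> (munit i j) $ k $ l)"
proof -
  interpret Vector_Spaces.linear cscale cscale \<Phi> by (rule assms)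
  have "(\<Sum>i\<in>UNIV. \<Sum>j\<in>UNIV. cscale (X $ i $ j) (munit i j)) $ a $ b = X $ a $ b" for a b
  proof -
    have "(\<Sum>i\<in>UNIV. \<Sum>j\<in>UNIV. cscale (X $ i $ j) (munit i j)) $ a $ b
        = (\<Sum>i\<in>UNIV. if i = a then (\<Sum>j\<in>UNIV. if j = b then X $ i $ j else 0) else 0)"
      unfolding sum_component
      by (intro sum.cong refl) (auto simp: cscale_def munit_def if_distrib cong: if_cong)
    then show ?thesis by simp
  qed
  then have "X = (\<Sum>i\<in>UNIV. \<Sum>j\<in>UNIV. cscale (X $ i $ j) (munit i j))"
    by (simp add: vec_eq_iff)
  then have "\<Phi> X = (\<Sum>i\<in>UNIV. \<Sum>j\<in>UNIV. cscale (X $ i $ j) (\<Phi> (munit i j)))"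
    by (metis (no_types, lifting) sum.cong sum scale)
  then show ?thesis by (simp add: cscale_def)
qed

lemma trace_munit_diag: "trace (munit i i :: complex^'n^'n) = 1"
  unfolding trace_def munit_def by simp

lemma cptp_populations_sum:
  assumes "cptp \<Phi>"
  shows "(\<Sum>k\<in>UNIV. Re (\<Phi> (munit i i) $ k $ k)) = 1"
proof -
  have "trace (\<Phi> (munit i i)) = 1"
    using assms by (simp add: cptp_def trace_munit_diag)
  then have "Re (trace (\<Phi> (munit i i))) = 1" by simp
  then show ?thesis by (simp add: trace_def)
qed

section \<open>Time evolution and the selection rule of covariance\<close>

abbreviation energy :: "4 \<Rightarrow> int" where
  "energy i \<equiv> (vector [0, 1, 1, 3] :: int^4) $ i"

lemma diag_mat_sandwich: "(diag_mat d ** X ** diag_mat e) $ i $ j = d $ i * X $ i $ j * e $ j"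
proof -
  have 1: "(diag_mat d ** X) $ i $ j = d $ i * X $ i $ j" for i j
  proof -
    have "(diag_mat d ** X) $ i $ j = (\<Sum>k\<in>UNIV. if k = i then d $ k * X $ k $ j else 0)"
      unfolding matrix_matrix_mult_def diag_mat_def vec_lambda_beta by (intro sum.cong) auto
    then show ?thesis by simp
  qed
  have "(Y ** diag_mat e) $ i $ j = Y $ i $ j * e $ j" for Y :: "complex^'a^'b"
  proof -
    have "(Y ** diag_mat e) $ i $ j = (\<Sum>k\<in>UNIV. if k = j then Y $ i $ k * e $ k else 0)"
      unfolding matrix_matrix_mult_def diag_mat_def vec_lambda_beta by (intro sum.cong) auto
    then show ?thesis by simp
  qed
  then show ?thesis by (simp add: 1)
qed

lemma evolution_component:
  "(mat_exp (cscale (- \<i> * of_real t) ham) ** X ** mat_exp (cscale (\<i> * of_real t) ham)) $ k $ l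
     = exp (\<i> * of_real (t * of_int (energy l - energy k))) * X $ k $ l"
proof -
  have "vector [1, exp c, exp c, exp (3 * c)] $ i = exp (c * of_int (energy i))" for c :: complex and i
    using exhaust_4[of i] by (auto simp: mult.commute)
  note e = this
  show ?thesis
    unfolding mat_exp_ham diag_mat_sandwich e
    by (simp add: algebra_simps flip: exp_add)
qed

text \<open>Evolution multiplies \<open>munit i j\<close> by the phase of the gap
  \<open>energy j - energy i\<close>, and the output entry by the phase of
  \<open>energy l - energy k\<close>. Covariance equates the two products at every time, so
  different gaps force the coefficient to vanish.\<close>

lemma covariant_munit_zero:
  assumes lin: "Vector_Spaces.linear cscale cscale \<Phi>" and cov: "covariant \<Phi>"
    and ne: "energy j - energy i \<noteq> energy l - energy k"
  shows "\<Phi> (munit i j) $ k $ l = 0"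
proof -
  define n where "n = (energy l - energy k) - (energy j - energy i)"
  \<comment> \<open>At this single time the relative phase of the two gaps is -1, so the coefficient
    equals its own negative.\<close>
  define t where "t = pi / of_int n"
  let ?e = "\<lambda>m::int. exp (\<i> * of_real (t * of_int m))"
  have n: "n \<noteq> 0" using ne by (simp add: n_def)
  have "mat_exp (cscale (- \<i> * of_real t) ham) ** munit i j ** mat_exp (cscale (\<i> * of_real t) ham)
      = cscale (?e (energy j - energy i)) (munit i j)"
    unfolding vec_eq_iff evolution_component by (auto simp: cscale_def munit_def)
  then have "cscale (?e (energy j - energy i)) (\<Phi> (munit i j)) =
      mat_exp (cscale (- \<i> * of_real t) ham) ** \<Phi> (munit i j) ** mat_exp (cscale (\<i> * of_real t) ham)"
    using lin cov unfolding covariant_def linear_cscale_iff by metis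
  from arg_cong[OF this, of "\<lambda>A. A $ k $ l"]
  have eq: "?e (energy j - energy i) * \<Phi> (munit i j) $ k $ l
      = ?e (energy l - energy k) * \<Phi> (munit i j) $ k $ l"
    unfolding evolution_component by (simp add: cscale_def)
  have "?e (energy l - energy k) = ?e (energy j - energy i) * ?e n"
    by (simp add: n_def algebra_simps flip: exp_add)
  also have "?e n = - 1"
    using n by (simp add: t_def)
  finally show ?thesis using eq by simp
qed

section \<open>A channel with prescribed transition probabilities and maximal coherences\<close>

text \<open>The channel with Kraus operators \<open>\<Sum>k. sqrt (P\<^sub>k\<^sub>k) |k\<rangle>\<langle>k|\<close> and \<open>sqrt (P\<^sub>k\<^sub>i) |k\<rangle>\<langle>i|\<close> for \<open>k \<noteq> i\<close>: it
  attains equality in \<open>completely_positive_gram\<close> for all coherences at once.\<close>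

definition scatter :: "real^'n^'n \<Rightarrow> complex^'n^'n \<Rightarrow> complex^'n^'n" where
  "scatter P X = (\<chi> k l. of_real (sqrt (P $ k $ k) * sqrt (P $ l $ l)) * X $ k $ l
     + (if k = l then \<Sum>i\<in>UNIV - {k}. of_real (P $ k $ i) * X $ i $ i else 0))"

lemma scatter_diag:
  assumes "P $ k $ k \<ge> 0"
  shows "scatter P X $ k $ k = (\<Sum>i\<in>UNIV. of_real (P $ k $ i) * X $ i $ i)"
  using assms by (simp add: scatter_def sum.remove[of UNIV k] flip: of_real_mult)

lemma scatter_offdiag:
  "k \<noteq> l \<Longrightarrow> scatter P X $ k $ l = of_real (sqrt (P $ k $ k * P $ l $ l)) * X $ k $ l"
  by (simp add: scatter_def real_sqrt_mult)

lemma linear_scatter: "Vector_Spaces.linear cscale cscale (scatter P)"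
  unfolding linear_cscale_iff
  by (auto simp: scatter_def cscale_def vec_eq_iff algebra_simps sum.distrib sum_distrib_left)

text \<open>Kraus decomposition at the level of forms: the first term comes from the diagonal Kraus
  operator, the others from the jumps from \<open>i\<close> to \<open>k\<close>, with the adjoint
  Kraus operators acting on \<open>x\<close> and \<open>y\<close>.\<close>

lemma braket_scatter:
  "braket x (scatter P M *v y) =
     braket (\<chi> k. of_real (sqrt (P $ k $ k)) * x $ k) (M *v (\<chi> k. of_real (sqrt (P $ k $ k)) * y $ k))
     + (\<Sum>k\<in>UNIV. \<Sum>i\<in>UNIV - {k}. of_real (P $ k $ i) * braket (axis i (x $ k)) (M *v axis i (y $ k)))"
proof -
  have "braket x (scatter P M *v y) =
    (\<Sum>k\<in>UNIV. \<Sum>l\<in>UNIV. cnj (x $ k) * (of_real (sqrt (P $ k $ k) * sqrt (P $ l $ l)) * M $ k $ l) * y $ l)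
    + (\<Sum>k\<in>UNIV. \<Sum>l\<in>UNIV. if l = k then cnj (x $ k) * (\<Sum>i\<in>UNIV - {k}. of_real (P $ k $ i) * M $ i $ i) * y $ l else 0)"
    unfolding braket_def matrix_vector_mult_def scatter_def vec_lambda_beta sum_distrib_left
      sum.distrib[symmetric]
    by (intro sum.cong refl) (auto simp: algebra_simps sum_distrib_left)
  also have "\<dots> =
    (\<Sum>k\<in>UNIV. \<Sum>l\<in>UNIV. cnj (x $ k) * (of_real (sqrt (P $ k $ k) * sqrt (P $ l $ l)) * M $ k $ l) * y $ l)
    + (\<Sum>k\<in>UNIV. \<Sum>i\<in>UNIV - {k}. of_real (P $ k $ i) * braket (axis i (x $ k)) (M *v axis i (y $ k)))"
  proof -
    have "cnj (x $ k) * (\<Sum>i\<in>UNIV - {k}. of_real (P $ k $ i) * M $ i $ i) * y $ k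
        = (\<Sum>i\<in>UNIV - {k}. of_real (P $ k $ i) * braket (axis i (x $ k)) (M *v axis i (y $ k)))" for k
      unfolding braket_axis_axis sum_distrib_left sum_distrib_right
      by (intro sum.cong refl) (simp add: algebra_simps)
    then show ?thesis by simp
  qed
  finally show ?thesis
    by (simp add: braket_def matrix_vector_mult_def sum_distrib_left algebra_simps)
qed

lemma nonneg_Reals_sum: "(\<And>i. i \<in> A \<Longrightarrow> f i \<in> \<real>\<^sub>\<ge>\<^sub>0) \<Longrightarrow> (\<Sum>i\<in>A. f i) \<in> \<real>\<^sub>\<ge>\<^sub>0"
  by (induction A rule: infinite_finite_induct) (auto intro: nonneg_Reals_add_I)

lemma completely_positive_scatter:
  assumes P: "\<And>j i. P $ j $ i \<ge> 0"
  shows "completely_positive (scatter P)"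
  unfolding completely_positive_def block_psd_def
proof (intro allI impI)
  fix n :: nat and X :: "nat \<Rightarrow> nat \<Rightarrow> complex^'a^'a" and v :: "nat \<Rightarrow> complex^'a"
  assume "\<forall>v. (\<Sum>a<n. \<Sum>b<n. braket (v a) (X a b *v v b)) \<in> \<real>\<^sub>\<ge>\<^sub>0"
  then have psd: "(\<Sum>a<n. \<Sum>b<n. braket (u a) (X a b *v u b)) \<in> \<real>\<^sub>\<ge>\<^sub>0" for u :: "nat \<Rightarrow> complex^'a"
    by blast
  \<comment> \<open>Moving the block sums innermost turns every Kraus term into the block form of
    \<open>X\<close> at one block vector, to which \<open>psd\<close> applies.\<close>
  have swap: "(\<Sum>a<n. \<Sum>b<n. \<Sum>k\<in>UNIV. \<Sum>i\<in>UNIV - {k}. of_real (P $ k $ i) * F a b k i)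
     = (\<Sum>k\<in>UNIV. \<Sum>i\<in>UNIV - {k}. of_real (P $ k $ i) * (\<Sum>a<n. \<Sum>b<n. F a b k i))"
    for F :: "nat \<Rightarrow> nat \<Rightarrow> 'a \<Rightarrow> 'a \<Rightarrow> complex"
  proof -
    have "(\<Sum>a<n. \<Sum>b<n. \<Sum>k\<in>UNIV. \<Sum>i\<in>UNIV - {k}. of_real (P $ k $ i) * F a b k i)
       = (\<Sum>k\<in>UNIV. \<Sum>a<n. \<Sum>b<n. \<Sum>i\<in>UNIV - {k}. of_real (P $ k $ i) * F a b k i)"
      by (subst sum.swap[of _ UNIV], subst (2) sum.swap) simp
    also have "\<dots> = (\<Sum>k\<in>UNIV. \<Sum>i\<in>UNIV - {k}. \<Sum>a<n. \<Sum>b<n. of_real (P $ k $ i) * F a b k i)"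
      by (intro sum.cong refl) (subst sum.swap[of _ "UNIV - _"], subst (2) sum.swap, simp)
    finally show ?thesis by (simp add: sum_distrib_left)
  qed
  show "(\<Sum>a<n. \<Sum>b<n. braket (v a) (scatter P (X a b) *v v b)) \<in> \<real>\<^sub>\<ge>\<^sub>0"
    unfolding braket_scatter sum.distrib swap
    by (intro nonneg_Reals_add_I nonneg_Reals_sum nonneg_Reals_mult_I psd)
      (use P in auto)
qed

lemma trace_scatter:
  assumes P: "\<And>j i. P $ j $ i \<ge> 0" and "\<And>i. (\<Sum>j\<in>UNIV. P $ j $ i) = 1"
  shows "trace (scatter P X) = trace X"
proof -
  have "trace (scatter P X) = (\<Sum>j\<in>UNIV. \<Sum>i\<in>UNIV. of_real (P $ j $ i) * X $ i $ i)"
    by (simp add: trace_def scatter_diag P)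
  also have "\<dots> = (\<Sum>i\<in>UNIV. of_real (\<Sum>j\<in>UNIV. P $ j $ i) * X $ i $ i)"
    by (subst sum.swap) (simp add: sum_distrib_right)
  finally show ?thesis by (simp add: assms(2) trace_def)
qed

text \<open>Off-diagonal entries are multiples of the same input entry, and diagonal entries combine
  diagonal ones, which have gap zero; hence all phases are respected.\<close>

lemma covariant_scatter: "covariant (scatter P)"
proof -
  have "scatter P Y $ k $ l = exp (\<i> * of_real (t * of_int (energy l - energy k))) * scatter P X $ k $ l"
    if "\<And>k l. Y $ k $ l = exp (\<i> * of_real (t * of_int (energy l - energy k))) * X $ k $ l"
    for X Y :: "complex^4^4" and t k l
    using that by (cases "k = l") (simp_all add: scatter_def)
  then show ?thesis
    unfolding covariant_def vec_eq_iff by (simp only: evolution_component simp_thms)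
qed

section \<open>The Gibbs state, populations and coherences in coordinates\<close>

abbreviation weight :: "real^4" where
  "weight \<equiv> vector [1, exp (- 1), exp (- 1), exp (- 3)]"

lemma gibbs_component:
  "gibbs $ i $ j = (if i = j then of_real (weight $ i / (1 + 2 * exp (- 1) + exp (- 3))) else 0)"
  using exhaust_4[of i]
  by (auto simp: gibbs_def Let_def cscale_def diag_mat_def simp flip: exp_of_real)

lemma partition_pos: "1 + 2 * exp (- 1) + exp (- 3) > (0::real)"
  by (intro add_pos_pos) auto

lemma trace_Proj:
  "trace (Proj0 ** X) = X $ 1 $ 1"
  "trace (Proj1 ** X) = X $ 2 $ 2 + X $ 3 $ 3"
  "trace (Proj3 ** X) = X $ 4 $ 4"
  by (simp_all add: trace_def Proj0_def Proj1_def Proj3_def matrix_matrix_mult_def ketbra_def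
      ket0_def ket1a_def ket1b_def ket3_def axis_def sum_4)

lemma L_component:
  "L01a \<rho> \<Phi> = Re (\<Phi> \<rho> $ 1 $ 2)"
  "L1b3 \<rho> \<Phi> = Re (\<Phi> \<rho> $ 3 $ 4)"
  "L03 \<rho> \<Phi> = Re (\<Phi> \<rho> $ 1 $ 4)"
  by (simp_all add: L01a_def L1b3_def L03_def ket0_def ket1a_def ket1b_def ket3_def braket_axis)

text \<open>The Gibbs state is diagonal, so only the action on populations has to be checked, and
  the partition function cancels.\<close>

lemma scatter_gibbs:
  assumes P: "\<And>j i. P $ j $ i \<ge> 0"
    and "P *v weight = weight"
  shows "scatter P gibbs = gibbs"
proof -
  define Z :: real where "Z = 1 + 2 * exp (- 1) + exp (- 3)"
  have "scatter P gibbs $ k $ l = gibbs $ k $ l" for k l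
  proof (cases "k = l")
    case True
    have "(\<Sum>i\<in>UNIV. P $ k $ i * weight $ i) = weight $ k"
      using arg_cong[OF assms(2), of "\<lambda>v. v $ k"] by (simp add: matrix_vector_mult_def)
    then have "(\<Sum>i\<in>UNIV. P $ k $ i * (weight $ i / Z)) = weight $ k / Z"
      by (simp flip: sum_divide_distrib)
    moreover have "scatter P gibbs $ k $ k = of_real (\<Sum>i\<in>UNIV. P $ k $ i * (weight $ i / Z))"
      unfolding scatter_diag[OF P] gibbs_component Z_def[symmetric] by simp
    ultimately show ?thesis
      using True by (simp add: gibbs_component Z_def)
  next
    case False
    then show ?thesis by (simp add: scatter_offdiag gibbs_component)
  qed
  then show ?thesis by (simp add: vec_eq_iff)
qed

section \<open>The constraints on the transition matrix and three feasible points\<close>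

text \<open>\<open>P $ j $ i\<close> is the probability of the transition from level \<open>i\<close> to level \<open>j\<close>, and \<open>q\<close> stands
  for \<open>exp (- 1)\<close>. The middle population is implied, since the columns of \<open>P\<close> sum to \<open>1\<close>.\<close>

definition feasible :: "real \<Rightarrow> real^4^4 \<Rightarrow> bool" where
  "feasible q P \<longleftrightarrow>
     (\<forall>j i. 0 \<le> P $ j $ i) \<and> (\<forall>i. (\<Sum>j\<in>UNIV. P $ j $ i) = 1) \<and>
     P *v vector [1, q, q, q ^ 3] = vector [1, q, q, q ^ 3] \<and>
     (P *v vector [0.35, 0.25, 0.20, 0.20]) $ 1 = 0.50 \<and>
     (P *v vector [0.35, 0.25, 0.20, 0.20]) $ 4 = 0.15"

lemma exp_minus_1_bounds: "0.3678794411 \<le> exp (- 1 :: real)" "exp (- 1 :: real) \<le> 0.3678794413"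
proof -
  \<comment> \<open>The rational number approximates \<open>exp 1\<close> to within 2^(-32); its
    reciprocal then yields both bounds.\<close>
  have "\<bar>exp 1 - 5837465777 / 2147483648\<bar> \<le> (1 / 4294967296 :: real)"
    using e_approx_32 by (simp add: inverse_eq_divide)
  then have "exp 1 \<le> (1 / 0.3678794411 :: real)" "(1 / 0.3678794413 :: real) \<le> exp 1"
    unfolding abs_le_iff by auto
  then show "0.3678794411 \<le> exp (- 1 :: real)" "exp (- 1 :: real) \<le> 0.3678794413"
    by (auto simp: exp_minus field_simps)
qed

lemma power_bounds:
  fixes q :: real
  assumes "0.3678794411 \<le> q" "q \<le> 0.3678794413"
  shows "0.1353352831 \<le> q\<^sup>2" "q\<^sup>2 \<le> 0.1353352834" "0.04978706825 \<le> q ^ 3" "q ^ 3 \<le> 0.0497870685"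
  using power_mono[OF assms(1), of 2] power_mono[OF assms(2), of 2]
    power_mono[OF assms(1), of 3] power_mono[OF assms(2), of 3] assms(1)
  by (simp_all add: power_divide)

text \<open>The Gibbs and population conditions are exact equations, so the entries of the witness
  are rational functions of \<open>q\<close>; the enclosure of \<open>q\<close> enters through
  inequalities. The same scheme serves the other two coherences.\<close>

lemma feasible_01a:
  fixes q :: real
  assumes q: "0.3678794411 \<le> q" "q \<le> 0.3678794413"
  shows "\<exists>P. feasible q P \<and> 0.64468946 \<le> sqrt (P $ 1 $ 1 * P $ 2 $ 2)"
proof -
  note qb = q power_bounds[OF q]
  define y where "y = (0.75 - q\<^sup>2) / (1 - q\<^sup>2)"
  define z where "z = (0.35 * q - 0.1) / (0.25 - 0.35 * q)"
  have y: "y * (1 - q\<^sup>2) = 0.75 - q\<^sup>2" "0 \<le> y" "y \<le> 1"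
    using qb by (auto simp: y_def field_simps)
  have z: "z * (0.25 - 0.35 * q) = 0.35 * q - 0.1" "0.23719303 \<le> z" "z \<le> 0.23719305"
    using qb unfolding z_def by (auto simp: le_divide_eq divide_le_eq)
  \<comment> \<open>Linear arithmetic treats products such as \<open>q * z\<close> as atoms, which
    therefore get their own bounds.\<close>
  have qz: "q * z \<le> 0.3678794413 * 0.23719305" "0 \<le> q * z"
    by (intro mult_mono mult_nonneg_nonneg; use qb z in simp)+
  have y': "0 \<le> q\<^sup>2 * (1 - y)" "q\<^sup>2 * (1 - y) \<le> 1"
    using y qb by (auto intro: mult_le_one)
  \<comment> \<open>The levels \<open>|0>\<close> and \<open>|1a>\<close> exchange in detailed
    balance with parameter \<open>z\<close>, while \<open>|0>\<close>, \<open>|1b>\<close> and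
    \<open>|3>\<close> form a cycle. The final population of \<open>|3>\<close> determines
    \<open>y\<close>, and then that of \<open>|0>\<close> determines \<open>z\<close>.\<close>
  let ?P = "vector [vector [1 - q - q * z, z, 1 - q\<^sup>2 * (1 - y), 1 - y],
                    vector [q * z, 1 - z, 0, 0],
                    vector [q, 0, 0, 0],
                    vector [0, 0, q\<^sup>2 * (1 - y), y]] :: real^4^4"
  have "feasible q ?P"
    unfolding feasible_def forall_4 sum_4 matrix_vector_mult_def vec_eq_iff vec_lambda_beta vector_4
    using qb y y' z qz by (simp add: algebra_simps power2_eq_square power3_eq_cube) (simp add: field_simps)
  moreover have "0.64468946 \<le> sqrt ((1 - q - q * z) * (1 - z))"
  proof (rule real_le_rsqrt)
    have "(0.64468946::real)\<^sup>2 \<le> (1 - 0.3678794413 - 0.3678794413 * 0.23719305) * (1 - 0.23719305)"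
      by (simp add: power2_eq_square)
    also have "\<dots> \<le> (1 - q - q * z) * (1 - z)"
      using qb z qz by (intro mult_mono) auto
    finally show "0.64468946\<^sup>2 \<le> (1 - q - q * z) * (1 - z)" .
  qed
  ultimately show ?thesis by (intro exI[of _ ?P]) simp
qed

lemma feasible_1b3:
  fixes q :: real
  assumes q: "0.3678794411 \<le> q" "q \<le> 0.3678794413"
  shows "\<exists>P. feasible q P \<and> 0.85213796 \<le> sqrt (P $ 3 $ 3 * P $ 4 $ 4)"
proof -
  note qb = q power_bounds[OF q]
  define y where "y = (0.15 - 0.35 * q ^ 3) / (0.2 - 0.35 * q ^ 3)"
  define w where "w = (0.35 * q - 0.1) / (0.2 - 0.35 * q ^ 3)"
  have y: "y * (0.2 - 0.35 * q ^ 3) = 0.15 - 0.35 * q ^ 3" "0.7261392 \<le> y" "y \<le> 0.73"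
    using qb unfolding y_def by (auto simp: le_divide_eq divide_le_eq)
  have w: "w * (0.2 - 0.35 * q ^ 3) = 0.35 * q - 0.1" "0 \<le> w" "w \<le> 0.2"
    using qb unfolding w_def by (auto simp: le_divide_eq divide_le_eq)
  have qw: "q ^ 3 * w \<le> 0.1 * 0.2" "0 \<le> q ^ 3 * w"
    by (intro mult_mono mult_nonneg_nonneg; use qb w in simp)+
  have qy: "q ^ 3 * (1 - y) \<le> 0.1 * 1" "0 \<le> q ^ 3 * (1 - y)"
    by (intro mult_mono mult_nonneg_nonneg; use qb y in simp)+
  \<comment> \<open>Leaving \<open>|1b>\<close> alone gives its diagonal entry the value 1. The
    population of \<open>|3>\<close> determines \<open>y\<close>, and that of \<open>|0>\<close>
    determines \<open>w\<close>.\<close>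
  let ?P = "vector [vector [1 - q - q ^ 3 * w, 1, 0, w],
                    vector [q + q ^ 3 * w - q ^ 3 * (1 - y), 0, 0, 1 - w - y],
                    vector [0, 0, 1, 0],
                    vector [q ^ 3 * (1 - y), 0, 0, y]] :: real^4^4"
  have "feasible q ?P"
    unfolding feasible_def forall_4 sum_4 matrix_vector_mult_def vec_eq_iff vec_lambda_beta vector_4
    using qb y w qw qy by (simp add: algebra_simps) (simp add: field_simps)
  moreover have "0.85213796 \<le> sqrt y"
    using y by (intro real_le_rsqrt) (simp add: power2_eq_square)
  ultimately show ?thesis by (intro exI[of _ ?P]) simp
qed

lemma feasible_03:
  fixes q :: real
  assumes q: "0.3678794411 \<le> q" "q \<le> 0.3678794413"
  shows "\<exists>P. feasible q P \<and> 0.704208325 \<le> sqrt (P $ 1 $ 1 * P $ 4 $ 4)"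
proof -
  note qb = q power_bounds[OF q]
  define y where "y = (0.15 - 0.35 * q ^ 3) / (0.2 - 0.35 * q ^ 3)"
  define z where "z = 0.1 / (0.25 - 0.35 * q)"
  have y: "y * (0.2 - 0.35 * q ^ 3) = 0.15 - 0.35 * q ^ 3" "0.72613922 \<le> y" "y \<le> 0.73"
    using qb unfolding y_def by (auto simp: le_divide_eq divide_le_eq)
  have z: "z * (0.25 - 0.35 * q) = 0.1" "0 \<le> z" "z \<le> 0.82479538"
    using qb unfolding z_def by (auto simp: le_divide_eq divide_le_eq)
  have qz: "q * z \<le> 0.3678794413 * 0.82479538" "0 \<le> q * z"
    by (intro mult_mono mult_nonneg_nonneg; use qb z in simp)+
  have qy: "q ^ 3 * (1 - y) \<le> 0.0497870685 * (1 - 0.72613922)" "0 \<le> q ^ 3 * (1 - y)"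
    by (intro mult_mono mult_nonneg_nonneg; use qb y in simp)+
  \<comment> \<open>The level \<open>|0>\<close> exchanges with \<open>|1a>\<close> and with
    \<open>|3>\<close> in detailed balance, and the rest of \<open>|1a>\<close> is swapped with
    \<open>|1b>\<close>. Again \<open>y\<close> comes from the population of \<open>|3>\<close> and
    \<open>z\<close> from that of \<open>|0>\<close>.\<close>
  let ?P = "vector [vector [1 - q * z - q ^ 3 * (1 - y), z, 0, 1 - y],
                    vector [q * z, 0, 1 - z, 0],
                    vector [0, 1 - z, z, 0],
                    vector [q ^ 3 * (1 - y), 0, 0, y]] :: real^4^4"
  have "feasible q ?P"
    unfolding feasible_def forall_4 sum_4 matrix_vector_mult_def vec_eq_iff vec_lambda_beta vector_4
    using qb y z qz qy by (simp add: algebra_simps) (simp add: field_simps)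
  moreover have "0.704208325 \<le> sqrt ((1 - q * z - q ^ 3 * (1 - y)) * y)"
  proof (rule real_le_rsqrt)
    have "(0.704208325::real)\<^sup>2 \<le> (1 - 0.3678794413 * 0.82479538 - 0.0497870685 * (1 - 0.72613922)) * 0.72613922"
      by (simp add: power2_eq_square)
    also have "\<dots> \<le> (1 - q * z - q ^ 3 * (1 - y)) * y"
      using qb y qz qy by (intro mult_mono) auto
    finally show "0.704208325\<^sup>2 \<le> (1 - q * z - q ^ 3 * (1 - y)) * y" .
  qed
  ultimately show ?thesis by (intro exI[of _ ?P]) simp
qed

section \<open>The dual bound for the sum\<close>

text \<open>Each of \<open>c1\<close>, \<open>c2\<close>, \<open>c3\<close> stands for a coherence
  factor, bounded as in \<open>completely_positive_gram\<close> with second weight 1. Such a bound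
  matches the square root of the product of the two diagonal entries exactly when the first weight
  is the square root of the second entry over the first; the three decimals fix this ratio in
  advance.\<close>

lemma feasible_sum_bound:
  fixes q :: real
  assumes q: "0.3678794411 \<le> q" "q \<le> 0.3678794413" and "feasible q P"
    and c1: "2 * 0.544376 * 1 * c1 \<le> 0.544376\<^sup>2 * P $ 1 $ 1 + 1\<^sup>2 * P $ 2 $ 2"
    and c2: "2 * 0.871066 * 1 * c2 \<le> 0.871066\<^sup>2 * P $ 3 $ 3 + 1\<^sup>2 * P $ 4 $ 4"
    and c3: "2 * 1.0361014 * 1 * c3 \<le> 1.0361014\<^sup>2 * P $ 1 $ 1 + 1\<^sup>2 * P $ 4 $ 4"
  shows "0.05 * c1 + 0.05 * c2 + 0.04 * c3 \<le> 0.0881264"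
proof -
  note qb = q power_bounds[OF q]
  \<comment> \<open>Rounded dual optimum of the linear program obtained by fixing the weights in \<open>c1\<close>, \<open>c2\<close>, \<open>c3\<close>:
    \<open>u\<close>, \<open>v\<close>, \<open>l\<close> are the multipliers of the column sums, the Gibbs condition and the populations.\<close>
  define u :: "real^4" where "u = vector [0.073731835, 0.073048568, 0.048901077, 0.090136074]"
  define v :: "real^4" where "v = vector [0.129632237, - 0.073731833, - 0.073731833, 0]"
  define l :: "real^4" where "l = vector [- 0.482950403, 0, 0, - 0.210662379]"
  define g :: "real^4" where "g = vector [1, q, q, q ^ 3]"
  define r :: "real^4" where "r = vector [0.35, 0.25, 0.20, 0.20]"
  \<comment> \<open>Objective coefficients of the diagonal entries: each hypothesis is divided by
    twice its weight and multiplied by 0.05, 0.05 or 0.04.\<close>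
  define c :: "real^4" where "c = vector [0.05 * 0.544376 / 2 + 0.04 * 1.0361014 / 2, 0.05 / 0.544376 / 2,
    0.05 * 0.871066 / 2, 0.05 / 0.871066 / 2 + 0.04 / 1.0361014 / 2]"
  have nn: "0 \<le> P $ j $ i" for j i using assms(3) by (simp add: feasible_def)
  have col: "(\<Sum>j\<in>UNIV. P $ j $ i) = 1" for i using assms(3) by (simp add: feasible_def)
  have row: "(\<Sum>i\<in>UNIV. P $ j $ i * g $ i) = g $ j" for j
    using assms(3) by (simp add: feasible_def g_def vec_eq_iff matrix_vector_mult_def)
  have pop: "(\<Sum>i\<in>UNIV. P $ 1 $ i * r $ i) = 0.5" "(\<Sum>i\<in>UNIV. P $ 4 $ i * r $ i) = 0.15"
    using assms(3) by (simp_all add: feasible_def r_def matrix_vector_mult_def)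
  have "0.05 * c1 + 0.05 * c2 + 0.04 * c3 \<le> (\<Sum>i\<in>UNIV. P $ i $ i * c $ i)"
    using c1 c2 c3 by (simp add: c_def sum_4 power2_eq_square)
  also have "\<dots> = (\<Sum>i\<in>UNIV. \<Sum>j\<in>UNIV. P $ j $ i * (if j = i then c $ i else 0))"
    by (simp add: if_distrib[of "\<lambda>x. _ * x"] cong: if_cong)
  \<comment> \<open>Weak duality: the dual constraints hold at all sixteen positions and are
    weighted by nonnegative entries of \<open>P\<close>.\<close>
  also have "\<dots> \<le> (\<Sum>i\<in>UNIV. \<Sum>j\<in>UNIV. P $ j $ i * (u $ i + v $ j * g $ i + l $ j * r $ i))"
  proof (intro sum_mono mult_left_mono nn)
    have "\<forall>i j. (if j = i then c $ i else 0) \<le> u $ i + v $ j * g $ i + l $ j * r $ i"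
      unfolding forall_4 using qb by (simp add: c_def u_def v_def g_def l_def r_def)
    then show "(if j = i then c $ i else 0) \<le> u $ i + v $ j * g $ i + l $ j * r $ i" for i j
      by blast
  qed
  also have "\<dots> = (\<Sum>i\<in>UNIV. u $ i * (\<Sum>j\<in>UNIV. P $ j $ i))
      + (\<Sum>j\<in>UNIV. v $ j * (\<Sum>i\<in>UNIV. P $ j $ i * g $ i))
      + (\<Sum>j\<in>UNIV. l $ j * (\<Sum>i\<in>UNIV. P $ j $ i * r $ i))"
    by (simp add: sum_4 algebra_simps)
  \<comment> \<open>The multiplier \<open>l\<close> vanishes at the two middle levels, so just the
    two prescribed populations contribute.\<close>
  also have "(\<Sum>j\<in>UNIV. l $ j * (\<Sum>i\<in>UNIV. P $ j $ i * r $ i)) = l $ 1 * 0.5 + l $ 4 * 0.15"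
    unfolding pop[symmetric] by (subst sum_4) (simp add: l_def)
  also have "(\<Sum>i\<in>UNIV. u $ i * (\<Sum>j\<in>UNIV. P $ j $ i))
      + (\<Sum>j\<in>UNIV. v $ j * (\<Sum>i\<in>UNIV. P $ j $ i * g $ i)) + (l $ 1 * 0.5 + l $ 4 * 0.15) \<le> 0.0881264"
    unfolding col row using qb by (simp add: sum_4 u_def v_def g_def l_def)
  finally show ?thesis .
qed


section \<open>From feasible matrices to channels\<close>

lemma scatter_in_Gamma_CGP:
  assumes P: "feasible (exp (- 1)) P"
    and r: "\<And>i. \<rho> $ i $ i = of_real (vector [0.35, 0.25, 0.20, 0.20] $ i)"
  shows "scatter P \<in> Gamma_CGP \<rho> (vector [0.50, 0.35, 0.15])"
proof -
  let ?r = "vector [0.35, 0.25, 0.20, 0.20] :: real^4"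
  have nn: "0 \<le> P $ j $ i" for j i using P by (simp add: feasible_def)
  have col: "(\<Sum>j\<in>UNIV. P $ j $ i) = 1" for i using P by (simp add: feasible_def)
  have e: "exp (- 1) ^ 3 = (exp (- 3) :: real)" by (simp flip: exp_of_nat_mult)
  have "P *v weight = weight" using P by (simp add: feasible_def e)
  then have "scatter P gibbs = gibbs" using nn by (rule scatter_gibbs[rotated])
  have d: "scatter P \<rho> $ k $ k = of_real ((P *v ?r) $ k)" for k
    unfolding scatter_diag[OF nn] r by (simp add: matrix_vector_mult_def)
  have "(\<Sum>k\<in>UNIV. (P *v ?r) $ k) = (\<Sum>i\<in>UNIV. (\<Sum>j\<in>UNIV. P $ j $ i) * ?r $ i)"
    unfolding matrix_vector_mult_def vec_lambda_beta sum_distrib_right by (rule sum.swap)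
  then have "(P *v ?r) $ 2 + (P *v ?r) $ 3 = 0.35"
    using P unfolding col feasible_def by (simp add: sum_4)
  then have "scatter P \<rho> $ 2 $ 2 + scatter P \<rho> $ 3 $ 3 = of_real 0.35"
    unfolding d by (simp only: flip: of_real_add)
  moreover have "scatter P \<rho> $ 1 $ 1 = of_real 0.50" "scatter P \<rho> $ 4 $ 4 = of_real 0.15"
    using P unfolding d by (simp_all only: feasible_def)
  ultimately show ?thesis
    using nn col \<open>scatter P gibbs = gibbs\<close>
    by (simp add: Gamma_CGP_def cptp_def linear_scatter completely_positive_scatter trace_scatter
        covariant_scatter trace_Proj)
qed

lemma covariant_diag_zero:
  assumes "Vector_Spaces.linear cscale cscale \<Phi>" "covariant \<Phi>"
  shows "energy i \<noteq> energy j \<Longrightarrow> \<Phi> (munit i j) $ k $ k = 0"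
  using covariant_munit_zero[OF assms, of j i k k] by simp

section \<open>From channels to feasible matrices\<close>

locale cgp =
  fixes \<rho> :: "complex^4^4" and pf :: "real^3" and \<Phi> :: "complex^4^4 \<Rightarrow> complex^4^4"
  assumes rho: "\<rho> = vector [vector [0.35, 0.05, 0,    0.04],
                              vector [0.05, 0.25, 0,    0   ],
                              vector [0,    0,    0.20, 0.05],
                              vector [0.04, 0,    0.05, 0.20]]"
    and pf: "pf = vector [0.50, 0.35, 0.15]"
    and Gamma: "\<Phi> \<in> Gamma_CGP \<rho> pf"
begin

lemma linear: "Vector_Spaces.linear cscale cscale \<Phi>"
  and cp: "completely_positive \<Phi>"
  and cptp: "cptp \<Phi>"
  and cov: "covariant \<Phi>"
  and gibbs: "\<Phi> gibbs = gibbs"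
  using Gamma by (auto simp: Gamma_CGP_def cptp_def)

definition P :: "real^4^4" where
  "P = (\<chi> j i. Re (\<Phi> (munit i i) $ j $ j))"

lemma diag: "\<Phi> (munit i i) $ j $ j = of_real (P $ j $ i)"
  using completely_positive_munit_diag[OF cp, of i j]
  by (simp add: P_def complex_nonneg_Reals_iff complex_eq_iff)

text \<open>Apart from populations, covariance lets only coherences between the degenerate levels
  \<open>|1a>\<close> and \<open>|1b>\<close> feed the diagonal, and these entries of \<rho> are
  zero.\<close>

lemma pop: "\<Phi> \<rho> $ k $ k = of_real ((P *v vector [0.35, 0.25, 0.20, 0.20]) $ k)"
  unfolding linear_munit_expand[OF linear, of \<rho>]
  unfolding rho sum_4 vector_4
  by (simp add: covariant_diag_zero[OF linear cov] diag matrix_vector_mult_def sum_4)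

text \<open>The degeneracy admits two input coherences with gap 1 and two with gap 2, but in each
  pair one entry of \<rho> is zero. A single term survives in every case.\<close>

lemma L01a: "L01a \<rho> \<Phi> = 0.05 * Re (\<Phi> (munit 1 2) $ 1 $ 2)"
  and L1b3: "L1b3 \<rho> \<Phi> = 0.05 * Re (\<Phi> (munit 3 4) $ 3 $ 4)"
  and L03: "L03 \<rho> \<Phi> = 0.04 * Re (\<Phi> (munit 1 4) $ 1 $ 4)"
  unfolding L_component linear_munit_expand[OF linear, of \<rho>]
  unfolding rho sum_4 vector_4
  by (simp_all add: covariant_munit_zero[OF linear cov])

text \<open>Positivity gives nonnegative entries, trace preservation the column sums, and the fixed
  Gibbs state the condition on \<open>weight\<close>, since a diagonal input reaches the output
  populations only through \<open>P\<close>.\<close>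

lemma feasible: "feasible (exp (- 1)) P"
proof -
  have e: "exp (- 1) ^ 3 = (exp (- 3) :: real)" by (simp flip: exp_of_nat_mult)
  have nn: "0 \<le> P $ j $ i" for j i
    using completely_positive_munit_diag[OF cp, of i j] by (simp add: diag)
  have col: "(\<Sum>j\<in>UNIV. P $ j $ i) = 1" for i
    using cptp_populations_sum[OF cptp] by (simp add: P_def)
  define Z :: real where "Z = 1 + 2 * exp (- 1) + exp (- 3)"
  have Z: "Z \<noteq> 0" using partition_pos by (simp add: Z_def)
  have "(P *v weight) $ k = weight $ k" for k
  proof -
    have "\<Phi> gibbs $ k $ k = (\<Sum>i\<in>UNIV. of_real (weight $ i / Z) * of_real (P $ k $ i))"
      unfolding linear_munit_expand[OF linear, of gibbs] gibbs_component Z_def[symmetric]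
      by (simp add: if_distrib[of "\<lambda>x. x * _"] diag cong: if_cong)
    also have "\<dots> = of_real ((P *v weight) $ k / Z)"
      by (simp add: matrix_vector_mult_def sum_divide_distrib mult.commute)
    finally show ?thesis
      using Z unfolding gibbs gibbs_component Z_def[symmetric] by (simp del: of_real_divide)
  qed
  then have "P *v weight = weight" by (simp add: vec_eq_iff)
  moreover have "(P *v vector [0.35, 0.25, 0.20, 0.20]) $ 1 = 0.50"
    "(P *v vector [0.35, 0.25, 0.20, 0.20]) $ 4 = 0.15"
    using Gamma unfolding Gamma_CGP_def mem_Collect_eq trace_Proj pop pf
    by (simp_all only: of_real_eq_iff vector_3)
  ultimately show ?thesis
    using nn col by (simp add: feasible_def e)
qed

lemma gram: "2 * \<alpha> * \<beta> * Re (\<Phi> (munit i j) $ i $ j) \<le> \<alpha>\<^sup>2 * P $ i $ i + \<beta>\<^sup>2 * P $ j $ j"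
  using completely_positive_gram[OF cp, of \<alpha> \<beta> i j i j] by (simp add: P_def)

lemma P_le_1: "P $ j $ i \<le> 1"
proof -
  have "P $ j $ i \<le> (\<Sum>j\<in>UNIV. P $ j $ i)"
    using feasible by (intro member_le_sum) (auto simp: feasible_def)
  then show ?thesis using feasible by (simp add: feasible_def)
qed

lemma coherence_le_1: "Re (\<Phi> (munit i j) $ i $ j) \<le> 1"
  using gram[of 1 1 i j] P_le_1[of i i] P_le_1[of j j] by simp

text \<open>Crude bounds, needed because a real supremum can be bounded below by a member only if
  the set is bounded above.\<close>

lemma L_le_1: "L01a \<rho> \<Phi> \<le> 1" "L1b3 \<rho> \<Phi> \<le> 1" "L03 \<rho> \<Phi> \<le> 1"
  unfolding L01a L1b3 L03
  using coherence_le_1[of 1 2] coherence_le_1[of 3 4] coherence_le_1[of 1 4] by simp_all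

lemma sum_bound: "L01a \<rho> \<Phi> + L1b3 \<rho> \<Phi> + L03 \<rho> \<Phi> \<le> 0.0881264"
  unfolding L01a L1b3 L03
  by (rule feasible_sum_bound[OF exp_minus_1_bounds feasible gram gram gram])

end

section \<open>Estimates of the suprema\<close>

theorem lemma4:
  fixes \<rho> :: "complex^4^4" and pf :: "real^3"
  assumes rho: "\<rho> = vector [vector [0.35, 0.05, 0,    0.04],
                              vector [0.05, 0.25, 0,    0   ],
                              vector [0,    0,    0.20, 0.05],
                              vector [0.04, 0,    0.05, 0.20]]"
    and pf: "pf = vector [0.50, 0.35, 0.15]"
  shows "(SUP \<Phi>\<in>Gamma_CGP \<rho> pf. L01a \<rho> \<Phi>) + (SUP \<Phi>\<in>Gamma_CGP \<rho> pf. L1b3 \<rho> \<Phi>)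
           + (SUP \<Phi>\<in>Gamma_CGP \<rho> pf. L03 \<rho> \<Phi>) \<ge> 0.1030097
       \<and> (0.1030097 :: real) > 0.1030090
       \<and> (SUP \<Phi>\<in>Gamma_CGP \<rho> pf. L01a \<rho> \<Phi> + L1b3 \<rho> \<Phi> + L03 \<rho> \<Phi>) \<le> 0.0881264
       \<and> (0.0881264 :: real) < 0.0881270"
proof -
  have cgp: "cgp \<rho> pf \<Phi>" if "\<Phi> \<in> Gamma_CGP \<rho> pf" for \<Phi>
    using that rho pf by unfold_locales
  have "\<rho> $ i $ i = of_real (vector [0.35, 0.25, 0.20, 0.20] $ i)" for i
    using exhaust_4[of i] by (auto simp: rho)
  note mem = scatter_in_Gamma_CGP[OF _ this, folded pf]
  have bdd: "bdd_above (L01a \<rho> ` Gamma_CGP \<rho> pf)" "bdd_above (L1b3 \<rho> ` Gamma_CGP \<rho> pf)"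
    "bdd_above (L03 \<rho> ` Gamma_CGP \<rho> pf)"
    using cgp.L_le_1[OF cgp] by (auto intro!: bdd_aboveI2)
  obtain P1 where P1: "feasible (exp (- 1)) P1" "0.64468946 \<le> sqrt (P1 $ 1 $ 1 * P1 $ 2 $ 2)"
    using feasible_01a[OF exp_minus_1_bounds] by blast
  have "0.05 * 0.64468946 \<le> L01a \<rho> (scatter P1)"
    using P1(2) by (simp add: L_component scatter_offdiag rho)
  also have "\<dots> \<le> (SUP \<Phi>\<in>Gamma_CGP \<rho> pf. L01a \<rho> \<Phi>)"
    by (intro cSUP_upper bdd mem P1)
  finally have 1: "0.05 * 0.64468946 \<le> (SUP \<Phi>\<in>Gamma_CGP \<rho> pf. L01a \<rho> \<Phi>)" .
  obtain P2 where P2: "feasible (exp (- 1)) P2" "0.85213796 \<le> sqrt (P2 $ 3 $ 3 * P2 $ 4 $ 4)"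
    using feasible_1b3[OF exp_minus_1_bounds] by blast
  have "0.05 * 0.85213796 \<le> L1b3 \<rho> (scatter P2)"
    using P2(2) by (simp add: L_component scatter_offdiag rho)
  also have "\<dots> \<le> (SUP \<Phi>\<in>Gamma_CGP \<rho> pf. L1b3 \<rho> \<Phi>)"
    by (intro cSUP_upper bdd mem P2)
  finally have 2: "0.05 * 0.85213796 \<le> (SUP \<Phi>\<in>Gamma_CGP \<rho> pf. L1b3 \<rho> \<Phi>)" .
  obtain P3 where P3: "feasible (exp (- 1)) P3" "0.704208325 \<le> sqrt (P3 $ 1 $ 1 * P3 $ 4 $ 4)"
    using feasible_03[OF exp_minus_1_bounds] by blast
  have "0.04 * 0.704208325 \<le> L03 \<rho> (scatter P3)"
    using P3(2) by (simp add: L_component scatter_offdiag rho)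
  also have "\<dots> \<le> (SUP \<Phi>\<in>Gamma_CGP \<rho> pf. L03 \<rho> \<Phi>)"
    by (intro cSUP_upper bdd mem P3)
  finally have 3: "0.04 * 0.704208325 \<le> (SUP \<Phi>\<in>Gamma_CGP \<rho> pf. L03 \<rho> \<Phi>)" .
  \<comment> \<open>An upper bound on a real supremum also needs a nonempty set;
    \<open>scatter P1\<close> is a member.\<close>
  have "(SUP \<Phi>\<in>Gamma_CGP \<rho> pf. L01a \<rho> \<Phi> + L1b3 \<rho> \<Phi> + L03 \<rho> \<Phi>) \<le> 0.0881264"
    using mem[OF P1(1)] cgp.sum_bound[OF cgp] by (intro cSUP_least) auto
  \<comment> \<open>The three lower bounds add up to 0.103009704 up to rounding in the ninth
    decimal.\<close>
  then show ?thesis using 1 2 3 by simp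
qed

end
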